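(* Let $X$ be a set with $n\ge5$ elements and let $\mathcal{S}$ be a maximum flat split system on $X$. Then $\mathcal{S}$ is orderly if and only if it is circular.
   Context: A distance on $X$ is a symmetric map $D:X\times X\to\mathbb{R}$ with $D(x,x)=0$, $D(x,y)\ge0$. A split of $X$ is a bipartition $\{A,B\}$ into two non-empty sets, written $A|B$; a split system on $X$ is a non-empty set of splits. For a split $S=A|B$, $D_S(x,y)=1$ if exactly one of $x,y$ lies in $A$ and $0$ otherwise; for a weighting $\omega:\mathcal{S}\to\mathbb{R}_{\ge0}$, $D_{(\mathcal{S},\omega)}=\sum_{S\in\mathcal{S}}\omega(S)D_S$. For a distance $D$ and $u\ne v$ let $X_{u,v}=\{x: D(u,x)<D(v,x)\}$, $E_{\{u,v\}}=\{x: D(u,x)=D(v,x)\}$, and for $q\ge\frac p2>0$ $$O_{p,q}(D)=\sum_{\substack{(u,v),\ u\neq v\\ \emptyset\subsetneq X_{u,v}\subsetneq X}}\tfrac{p}{2} D_{X_{u,v}|X-X_{u,v}}+\sum_{\substack{\{u,v\},\ u\ne v\\ \emptyset\subsetneq E_{\{u,v\}}\subsetneq X}}\left(q-\tfrac p2\right)D_{E_{\{u,v\}}|X-E_{\{u,v\}}}.$$ $\mathcal{S}$ is orderly if for all $q=\frac p2>0$ and every non-negative weighting $\omega$ of $\mathcal{S}$ there is a non-negative weighting $\omega'$ of $\mathcal{S}$ with $O_{p,q}(D_{(\mathcal{S},\omega)})=D_{(\mathcal{S},\omega')}$. $\mathcal{S}$ is circular if there is an ordering $x_1,\dots,x_n$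 of $X$ such that every split in $\mathcal{S}$ has the form $\{x_i,\dots,x_j\}|X-\{x_i,\dots,x_j\}$ with $1\le i\le j<n$. Flatness: for an ordering $\pi=(x_1,\dots,x_n)$ of $X$ and $k\in\{1,\dots,n-1\}$ let $\pi(k)$ be obtained by swapping $x_k,x_{k+1}$, $sw(\pi,k)=\{x_k,x_{k+1}\}$, $S(\pi,k)=\{x_1,\dots,x_k\}|\{x_{k+1},\dots,x_n\}$. With $m=\binom n2$, a pair $(\pi,\kappa)$, $\kappa=(k_1,\dots,k_m)\in\{1,\dots,n-1\}^m$, is allowable if, with $\pi_0=\pi$, $\pi_i=\pi_{i-1}(k_i)$, the sets $sw(\pi_{i-1},k_i)$ ($1\le i\le m$) are pairwise distinct; $\mathcal{S}_{(\pi,\kappa)}=\{S(\pi_{i-1},k_i):1\le i\le m\}$. A split system is flat if contained in some $\mathcal{S}_{(\pi,\kappa)}$ with $(\pi,\kappa)$ allowable, and maximum flat if it is flat of size $\binom n2$. *)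

theory Defs
  imports Complex_Main
begin

text \<open>
  The split \<open>A|B\<close> is the set \<open>{A, B}\<close> of its two parts.  Distances on \<open>X\<close> are functions
  \<open>'a \<Rightarrow> 'a \<Rightarrow> real\<close> of which only the values on \<open>X \<times> X\<close> matter.
\<close>

definition is_split :: "'a set \<Rightarrow> 'a set set \<Rightarrow> bool" where
  "is_split X S \<longleftrightarrow>
     (\<exists>A B. S = {A, B} \<and> A \<noteq> {} \<and> B \<noteq> {} \<and> A \<inter> B = {} \<and> A \<union> B = X)"

definition split_system :: "'a set \<Rightarrow> 'a set set set \<Rightarrow> bool" where
  "split_system X \<S> \<longleftrightarrow> \<S> \<noteq> {} \<and> (\<forall>S\<in>\<S>. is_split X S)"

text \<open>For a split \<open>{A, B}\<close> of \<open>X\<close> and \<open>x, y \<in> X\<close>, exactly one of \<open>x, y\<close> lies in \<open>A\<close> iff exactly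
  one of them lies in \<open>B\<close>, so it does not matter which part witnesses the existential.\<close>

definition split_dist :: "'a set set \<Rightarrow> 'a \<Rightarrow> 'a \<Rightarrow> real" where
  "split_dist S x y = (if \<exists>A\<in>S. (x \<in> A) \<noteq> (y \<in> A) then 1 else 0)"

definition weighted_dist :: "'a set set set \<Rightarrow> ('a set set \<Rightarrow> real) \<Rightarrow> 'a \<Rightarrow> 'a \<Rightarrow> real" where
  "weighted_dist \<S> \<omega> x y = (\<Sum>S\<in>\<S>. \<omega> S * split_dist S x y)"

definition closer_set :: "'a set \<Rightarrow> ('a \<Rightarrow> 'a \<Rightarrow> real) \<Rightarrow> 'a \<Rightarrow> 'a \<Rightarrow> 'a set" where
  "closer_set X D u v = {x \<in> X. D u x < D v x}"

text \<open>The second argument is an unordered pair \<open>{u, v}\<close>.\<close>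

definition equidistant_set :: "'a set \<Rightarrow> ('a \<Rightarrow> 'a \<Rightarrow> real) \<Rightarrow> 'a set \<Rightarrow> 'a set" where
  "equidistant_set X D e = {x \<in> X. \<forall>u\<in>e. \<forall>v\<in>e. D u x = D v x}"

definition order_dist ::
  "'a set \<Rightarrow> real \<Rightarrow> real \<Rightarrow> ('a \<Rightarrow> 'a \<Rightarrow> real) \<Rightarrow> 'a \<Rightarrow> 'a \<Rightarrow> real" where
  "order_dist X p q D x y =
     (\<Sum>(u, v) \<in> {(u, v). u \<in> X \<and> v \<in> X \<and> u \<noteq> v \<and>
                      {} \<subset> closer_set X D u v \<and> closer_set X D u v \<subset> X}.
        p / 2 * split_dist {closer_set X D u v, X - closer_set X D u v} x y)
   + (\<Sum>e \<in> {{u, v} | u v. u \<in> X \<and> v \<in> X \<and> u \<noteq> v \<and>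
                      {} \<subset> equidistant_set X D {u, v} \<and> equidistant_set X D {u, v} \<subset> X}.
        (q - p / 2) * split_dist {equidistant_set X D e, X - equidistant_set X D e} x y)"

definition orderly :: "'a set \<Rightarrow> 'a set set set \<Rightarrow> bool" where
  "orderly X \<S> \<longleftrightarrow>
     (\<forall>p q. q = p / 2 \<and> p / 2 > 0 \<longrightarrow>
       (\<forall>\<omega>. (\<forall>S\<in>\<S>. 0 \<le> \<omega> S) \<longrightarrow>
         (\<exists>\<omega>'. (\<forall>S\<in>\<S>. 0 \<le> \<omega>' S) \<and>
            (\<forall>x\<in>X. \<forall>y\<in>X. order_dist X p q (weighted_dist \<S> \<omega>) x y = weighted_dist \<S> \<omega>' x y))))"

text \<open>
  An ordering \<open>x\<^sub>1, \<dots>, x\<^sub>n\<close> of \<open>X\<close> is a list \<open>\<pi>\<close>.  The positions \<open>i, j, k\<close> below are 1-based, so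
  that \<open>x\<^sub>k\<close> is \<open>\<pi> ! (k - 1)\<close>.
\<close>

definition is_ordering :: "'a set \<Rightarrow> 'a list \<Rightarrow> bool" where
  "is_ordering X \<pi> \<longleftrightarrow> distinct \<pi> \<and> set \<pi> = X"

definition circular :: "'a set \<Rightarrow> 'a set set set \<Rightarrow> bool" where
  "circular X \<S> \<longleftrightarrow>
     (\<exists>\<pi>. is_ordering X \<pi> \<and>
       (\<forall>S\<in>\<S>. \<exists>i j. 1 \<le> i \<and> i \<le> j \<and> j < card X \<and>
          S = {(\<lambda>l. \<pi> ! (l - 1)) ` {i..j}, X - (\<lambda>l. \<pi> ! (l - 1)) ` {i..j}}))"

definition swap_at :: "'a list \<Rightarrow> nat \<Rightarrow> 'a list" where
  "swap_at \<pi> k = \<pi>[k - 1 := \<pi> ! k, k := \<pi> ! (k - 1)]"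

definition sw :: "'a list \<Rightarrow> nat \<Rightarrow> 'a set" where
  "sw \<pi> k = {\<pi> ! (k - 1), \<pi> ! k}"

definition prefix_split :: "'a list \<Rightarrow> nat \<Rightarrow> 'a set set" where
  "prefix_split \<pi> k = {set (take k \<pi>), set (drop k \<pi>)}"

text \<open>\<open>swap_seq \<pi> \<kappa> i\<close> is \<open>\<pi>\<^sub>i\<close>; since lists are 0-based, \<open>k\<^sub>i\<^sub>+\<^sub>1\<close> is \<open>\<kappa> ! i\<close>.\<close>

primrec swap_seq :: "'a list \<Rightarrow> nat list \<Rightarrow> nat \<Rightarrow> 'a list" where
  "swap_seq \<pi> \<kappa> 0 = \<pi>"
| "swap_seq \<pi> \<kappa> (Suc i) = swap_at (swap_seq \<pi> \<kappa> i) (\<kappa> ! i)"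

definition allowable :: "'a set \<Rightarrow> 'a list \<Rightarrow> nat list \<Rightarrow> bool" where
  "allowable X \<pi> \<kappa> \<longleftrightarrow>
     is_ordering X \<pi> \<and> length \<kappa> = card X choose 2 \<and> set \<kappa> \<subseteq> {1..card X - 1} \<and>
     inj_on (\<lambda>i. sw (swap_seq \<pi> \<kappa> i) (\<kappa> ! i)) {..<length \<kappa>}"

definition allowable_splits :: "'a list \<Rightarrow> nat list \<Rightarrow> 'a set set set" where
  "allowable_splits \<pi> \<kappa> = (\<lambda>i. prefix_split (swap_seq \<pi> \<kappa> i) (\<kappa> ! i)) ` {..<length \<kappa>}"

definition flat :: "'a set \<Rightarrow> 'a set set set \<Rightarrow> bool" where
  "flat X \<S> \<longleftrightarrow>
     split_system X \<S> \<and> (\<exists>\<pi> \<kappa>. allowable X \<pi> \<kappa> \<and> \<S> \<subseteq> allowable_splits \<pi> \<kappa>)"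

definition maximum_flat :: "'a set \<Rightarrow> 'a set set set \<Rightarrow> bool" where
  "maximum_flat X \<S> \<longleftrightarrow> flat X \<S> \<and> card \<S> = card X choose 2"

end

(*
  Circular implies orderly: by counting, S consists of all circular splits of an ordering. For a
  weighted sum D of these, every set {x. D u x < D v x} is an interval of the circular ordering, so
  the order distance is a non-negative combination of splits in S.

  Orderly implies circular: S consists of all initial segments of the orders occurring in a sweep
  from an order of X to its reverse that reverses every pair once. An element d that first moves
  down and later up must turn at the very bottom: otherwise two splits in S, with weights 1, yield
  an order distance violating a four-point inequality valid on S. So every element makes its upward
  moves before its downward ones, or conversely, and listing the former in their original order and
  the latter backwards gives the circular ordering.
*)

theory Submission
  imports Defs
begin

section \<open>Circular split systems\<close>

lemma split_dist_compl:
  assumes "x \<in> X" "y \<in> X"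
  shows "split_dist {A, X - A} x y = of_bool ((x \<in> A) \<noteq> (y \<in> A))"
  using assms by (auto simp: split_dist_def)

text \<open>This four-point form of being an arc is invariant under complement and rotation, so arcs
  that wrap around the end of the list need no separate treatment.\<close>

definition noncrossing :: "'a list \<Rightarrow> 'a set \<Rightarrow> bool" where
  "noncrossing \<pi> A \<longleftrightarrow> (\<forall>a b c d. a < b \<and> b < c \<and> c < d \<and> d < length \<pi> \<longrightarrow>
     \<not> ((\<pi> ! a \<in> A \<longleftrightarrow> \<pi> ! c \<in> A) \<and> (\<pi> ! b \<in> A \<longleftrightarrow> \<pi> ! d \<in> A) \<and> (\<pi> ! a \<in> A \<longleftrightarrow> \<pi> ! b \<notin> A)))"

text \<open>The bound \<open>j < card X\<close> selects the part that avoids the last element, so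
  each split of an ordering has one index pair.\<close>

definition circular_splits :: "'a set \<Rightarrow> 'a list \<Rightarrow> 'a set set set" where
  "circular_splits X \<pi> = (\<lambda>(i, j). {(\<lambda>l. \<pi> ! (l - 1)) ` {i..j}, X - (\<lambda>l. \<pi> ! (l - 1)) ` {i..j}}) `
     {(i, j). 1 \<le> i \<and> i \<le> j \<and> j < card X}"

lemma circular_iff_subset:
  "circular X \<S> \<longleftrightarrow> (\<exists>\<pi>. is_ordering X \<pi> \<and> \<S> \<subseteq> circular_splits X \<pi>)"
proof -
  have "\<S> \<subseteq> circular_splits X \<pi> \<longleftrightarrow> (\<forall>S\<in>\<S>. \<exists>i j. 1 \<le> i \<and> i \<le> j \<and> j < card X \<and>
          S = {(\<lambda>l. \<pi> ! (l - 1)) ` {i..j}, X - (\<lambda>l. \<pi> ! (l - 1)) ` {i..j}})" for \<pi>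
    unfolding circular_splits_def subset_iff image_iff Bex_def by auto
  then show ?thesis
    unfolding circular_def by simp
qed

text \<open>This bound forces a circular system of \<open>card X choose 2\<close> splits to be the
  full circular system of its ordering.\<close>

lemma card_circular_splits:
  shows "finite (circular_splits X \<pi>)" "card (circular_splits X \<pi>) \<le> card X choose 2"
proof -
  have eq: "{(i, j). 1 \<le> i \<and> i \<le> j \<and> j < n} = (SIGMA j:{..<n}. {1..j})\<inverse>" for n :: nat
    by auto
  have card: "card {(i, j). 1 \<le> i \<and> i \<le> j \<and> j < n} = n choose 2" for n :: nat
  proof -
    have "card ((SIGMA j:{..<n}. {1..j})\<inverse>) = card (SIGMA j:{..<n}. {1..j})"
      by (rule card_inverse)
    also have "\<dots> = \<Sum> {..<n}"
      by (subst card_SigmaI) auto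
    also have "\<dots> = n choose 2"
      by (induction n) (auto simp: numeral_2_eq_2)
    finally show ?thesis by (simp only: eq)
  qed
  have fin: "finite {(i, j). 1 \<le> i \<and> i \<le> j \<and> j < n}" for n :: nat
    by (rule finite_subset[of _ "{..n} \<times> {..n}"]) auto
  show "finite (circular_splits X \<pi>)"
    unfolding circular_splits_def by (rule finite_imageI[OF fin])
  show "card (circular_splits X \<pi>) \<le> card X choose 2"
    unfolding circular_splits_def card[symmetric] by (rule card_image_le[OF fin])
qed

text \<open>Take the part that avoids the last position. A gap between its least and greatest
  positions would alternate with these two and the last position, so the part is an
  interval.\<close>

lemma noncrossing_circular_split:
  assumes ord: "is_ordering X \<pi>" and nc: "noncrossing \<pi> A"
    and A: "A \<subseteq> X" "A \<noteq> {}" "A \<noteq> X"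
  shows "{A, X - A} \<in> circular_splits X \<pi>"
proof -
  have X: "set \<pi> = X" and len: "length \<pi> = card X"
    using ord distinct_card unfolding is_ordering_def by force+
  have main: "\<exists>i j. 1 \<le> i \<and> i \<le> j \<and> j < card X \<and> B = (\<lambda>l. \<pi> ! (l - 1)) ` {i..j}"
    if B: "B \<subseteq> X" "B \<noteq> {}" "noncrossing \<pi> B" "\<pi> ! (card X - 1) \<notin> B" for B
  proof -
    define I where "I = {l. l < card X \<and> \<pi> ! l \<in> B}"
    have finI: "finite I" unfolding I_def by auto
    have BI: "B = (\<lambda>l. \<pi> ! l) ` I"
      using B(1) X len unfolding I_def by (auto simp: in_set_conv_nth image_iff) (metis in_set_conv_nth subsetD)
    then have "I \<noteq> {}" using B(2) by auto
    define a where "a = Min I"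
    define b where "b = Max I"
    have ab: "a \<in> I" "b \<in> I" "a \<le> b"
      using finI \<open>I \<noteq> {}\<close> unfolding a_def b_def by auto
    have last: "l \<noteq> card X - 1" if "l \<in> I" for l
      using that B(4) unfolding I_def by auto
    have "l \<in> I" if l: "a \<le> l" "l \<le> b" for l
    proof (rule ccontr)
      assume "l \<notin> I"
      then have "a < l" "l < b" using l ab by (auto simp: order.order_iff_strict)
      moreover have "b < card X - 1" using ab(2) last[OF ab(2)] unfolding I_def by auto
      ultimately show False
        using B(3)[unfolded noncrossing_def, rule_format, of a l b "card X - 1"] B(4) ab \<open>l \<notin> I\<close>
        unfolding I_def by (auto simp: len)
    qed
    moreover have "a \<le> l \<and> l \<le> b" if "l \<in> I" for l
      using that finI unfolding a_def b_def by auto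
    ultimately have "I = {a..b}" unfolding set_eq_iff atLeastAtMost_iff by blast
    moreover have "(\<lambda>l. \<pi> ! (l - 1)) ` {Suc a..Suc b} = (\<lambda>l. \<pi> ! l) ` {a..b}"
      unfolding image_Suc_atLeastAtMost[symmetric] image_image by simp
    moreover have "b < card X - 1" using ab(2) last[OF ab(2)] unfolding I_def by auto
    ultimately show ?thesis
      using BI ab by (intro exI[of _ "Suc a"] exI[of _ "Suc b"]) auto
  qed
  have inX: "\<pi> ! l \<in> X" if "l < length \<pi>" for l
    using that X by auto
  have "noncrossing \<pi> (X - A)"
    using nc inX unfolding noncrossing_def by (simp add: less_imp_le_nat)
  then obtain B where B: "B = A \<or> B = X - A" "B \<subseteq> X" "B \<noteq> {}" "noncrossing \<pi> B"
      "\<pi> ! (card X - 1) \<notin> B"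
    using nc A by (cases "\<pi> ! (card X - 1) \<in> A") auto
  then have "{A, X - A} = {B, X - B}" using A(1) by auto
  then show ?thesis
    using main[OF B(2-5)] unfolding circular_splits_def image_def by auto
qed

section \<open>Full circular systems are orderly\<close>

lemma order_dist_half:
  assumes "q = p / 2"
  shows "order_dist X p q D x y =
    (\<Sum>(u, v) \<in> {(u, v). u \<in> X \<and> v \<in> X \<and> u \<noteq> v \<and>
                      {} \<subset> closer_set X D u v \<and> closer_set X D u v \<subset> X}.
        p / 2 * split_dist {closer_set X D u v, X - closer_set X D u v} x y)"
proof -
  have "q - p / 2 = 0" using assms by simp
  then show ?thesis unfolding order_dist_def by (simp only: mult_zero_left sum.neutral_const add_0_right)
qed

text \<open>\<open>x\<close> comes no later than \<open>y\<close> on one of the two arcs from position \<open>s\<close> to position \<open>t\<close> of a cycle.\<close>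

definition toward :: "nat \<Rightarrow> nat \<Rightarrow> nat \<Rightarrow> nat \<Rightarrow> bool" where
  "toward s t x y \<longleftrightarrow>
     s < t \<and> (s \<le> x \<and> x \<le> y \<and> y \<le> t \<or> x \<le> s \<and> (y \<le> x \<or> t \<le> y) \<or> t \<le> y \<and> y \<le> x) \<or>
     t < s \<and> (t \<le> y \<and> y \<le> x \<and> x \<le> s \<or> s \<le> x \<and> (x \<le> y \<or> y \<le> t) \<or> x \<le> y \<and> y \<le> t)"

lemma toward_interval:
  assumes "toward s t x y"
  shows "s \<in> {i..j} \<Longrightarrow> t \<notin> {i..j} \<Longrightarrow> y \<in> {i..j} \<Longrightarrow> x \<in> {i..j}"
    and "t \<in> {i..j} \<Longrightarrow> s \<notin> {i..j} \<Longrightarrow> x \<in> {i..j} \<Longrightarrow> y \<in> {i..j}"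
  using assms unfolding toward_def atLeastAtMost_iff de_Morgan_conj not_le
  by (elim disjE conjE; intro conjI; linarith)+

text \<open>If every \<open>a, c\<close> preceded every \<open>b, d\<close> on each arc, alternation
  would allow only two points per arc, hence exactly two on each. Since the arcs run around the
  cycle in opposite directions, one of them would then have its two points in the wrong order. For a
  function decreasing along both arcs, the two claims exclude both alternating patterns of its
  positive set.\<close>

lemma toward_alternating:
  assumes "a < b" "b < c" "c < d" "s \<noteq> t"
  shows "toward s t b a \<or> toward s t b c \<or> toward s t d a \<or> toward s t d c"
    and "toward s t a b \<or> toward s t a d \<or> toward s t c b \<or> toward s t c d"
proof -
  consider "s < t" "b \<le> s" | "s < t" "s < b" "c \<le> t" | "s < t" "s < b" "t < c"
    | "t < s" "s \<le> b" | "t < s" "b < s" "t \<le> a" | "t < s" "b < s" "a < t" "s \<le> d"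
    | "t < s" "d < s" "t \<le> c" | "t < s" "d < s" "c < t"
    by (meson assms(4) linorder_neqE_nat not_le)
  then show "toward s t b a \<or> toward s t b c \<or> toward s t d a \<or> toward s t d c"
  proof cases
    case 1 then have "toward s t b a" using assms by (simp add: toward_def)
    then show ?thesis by simp
  next
    case 2 then have "toward s t b c" using assms by (simp add: toward_def)
    then show ?thesis by simp
  next
    case 3 then have "toward s t d c" using assms by (simp add: toward_def)
    then show ?thesis by simp
  next
    case 4 then have "toward s t b c" using assms by (simp add: toward_def)
    then show ?thesis by simp
  next
    case 5 then have "toward s t b a" using assms by (simp add: toward_def)
    then show ?thesis by simp
  next
    case 6 then have "toward s t d a" using assms by (simp add: toward_def)
    then show ?thesis by simp
  next
    case 7 then have "toward s t d c" using assms by (simp add: toward_def)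
    then show ?thesis by simp
  next
    case 8 then have "toward s t b c" using assms by (simp add: toward_def)
    then show ?thesis by simp
  qed
  consider "s < t" "c \<le> s" | "s < t" "s < c" "d \<le> t" | "s < t" "a \<le> s" "t < d"
    | "s < t" "s < a" "t \<le> b" | "s < t" "s < a" "b < t"
    | "t < s" "s \<le> a" | "t < s" "s \<le> c" | "t < s" "c < s" "t \<le> b" | "t < s" "b < t"
    by (meson assms(4) linorder_neqE_nat not_le)
  then show "toward s t a b \<or> toward s t a d \<or> toward s t c b \<or> toward s t c d"
  proof cases
    case 1 then have "toward s t c b" using assms by (simp add: toward_def)
    then show ?thesis by simp
  next
    case 2 then have "toward s t c d" using assms by (simp add: toward_def)
    then show ?thesis by simp
  next
    case 3 then have "toward s t a d" using assms by (simp add: toward_def)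
    then show ?thesis by simp
  next
    case 4 then have "toward s t c b" using assms by (simp add: toward_def)
    then show ?thesis by simp
  next
    case 5 then have "toward s t a b" using assms by (simp add: toward_def)
    then show ?thesis by simp
  next
    case 6 then have "toward s t a b" using assms by (simp add: toward_def)
    then show ?thesis by simp
  next
    case 7 then have "toward s t c d" using assms by (simp add: toward_def)
    then show ?thesis by simp
  next
    case 8 then have "toward s t c b" using assms by (simp add: toward_def)
    then show ?thesis by simp
  next
    case 9 then have "toward s t a b" using assms by (simp add: toward_def)
    then show ?thesis by simp
  qed
qed
text \<open>Only splits separating \<open>u\<close> from \<open>v\<close> contribute to \<open>D v - D u\<close>, and in a circular ordering
  such a split cuts each of the two arcs from \<open>u\<close> to \<open>v\<close> exactly once, so that \<open>D v - D u\<close> decreases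
  along both arcs.\<close>

lemma noncrossing_closer_set:
  assumes ord: "is_ordering X \<pi>" and \<S>: "\<S> \<subseteq> circular_splits X \<pi>"
    and w: "\<forall>S\<in>\<S>. 0 \<le> \<omega> S" and uv: "u \<in> X" "v \<in> X" "u \<noteq> v"
  shows "noncrossing \<pi> (closer_set X (weighted_dist \<S> \<omega>) u v)"
proof -
  have dist: "distinct \<pi>" and X: "set \<pi> = X" and len: "length \<pi> = card X"
    using ord distinct_card unfolding is_ordering_def by force+
  define N where "N = card X"
  obtain s t where st: "s < N" "t < N" "u = \<pi> ! s" "v = \<pi> ! t" "s \<noteq> t"
    using uv X len N_def by (metis in_set_conv_nth)
  define f where "f l = weighted_dist \<S> \<omega> v (\<pi> ! l) - weighted_dist \<S> \<omega> u (\<pi> ! l)" for l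
  have mono: "f y \<le> f x" if "toward s t x y" "x < N" "y < N" for x y
  proof -
    have "split_dist S v (\<pi> ! y) - split_dist S u (\<pi> ! y) \<le> split_dist S v (\<pi> ! x) - split_dist S u (\<pi> ! x)"
      if S: "S \<in> \<S>" for S
    proof -
      obtain i j where ij: "1 \<le> i" "i \<le> j" "j < card X"
          "S = {(\<lambda>l. \<pi> ! (l - 1)) ` {i..j}, X - (\<lambda>l. \<pi> ! (l - 1)) ` {i..j}}"
        using \<S> S unfolding circular_splits_def by auto
      define A where "A = (\<lambda>l. \<pi> ! (l - 1)) ` {i..j}"
      \<comment> \<open>List positions are 0-based while \<open>i, j\<close> are 1-based; shifting
        all positions by one preserves \<open>toward\<close>.\<close>
      define m where "m l \<longleftrightarrow> Suc l \<in> {i..j}" for l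
      have mem: "\<pi> ! l \<in> A \<longleftrightarrow> m l" if "l < N" for l
      proof
        assume "\<pi> ! l \<in> A"
        then obtain r where "r \<in> {i..j}" "\<pi> ! l = \<pi> ! (r - 1)" unfolding A_def by auto
        then have "l = r - 1" using dist that ij len N_def nth_eq_iff_index_eq[of \<pi> l "r - 1"] by auto
        with \<open>r \<in> {i..j}\<close> ij show "m l" unfolding m_def by auto
      qed (auto simp: image_iff m_def A_def intro!: bexI[of _ "Suc l"])
      have inX: "\<pi> ! l \<in> X" if "l < N" for l
        using that X len N_def by auto
      have "toward (Suc s) (Suc t) (Suc x) (Suc y)"
        using \<open>toward s t x y\<close> unfolding toward_def by simp
      then have "m s \<and> \<not> m t \<and> m y \<longrightarrow> m x" "m t \<and> \<not> m s \<and> m x \<longrightarrow> m y"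
        using toward_interval[of "Suc s" "Suc t" "Suc x" "Suc y" i j] unfolding m_def by blast+
      \<comment> \<open>A split that does not separate \<open>u\<close> from \<open>v\<close>
        contributes 0 on both sides; the other two cases are the implications just shown.\<close>
      then have "of_bool (m t \<noteq> m y) - of_bool (m s \<noteq> m y)
          \<le> (of_bool (m t \<noteq> m x) - of_bool (m s \<noteq> m x) :: real)"
        by (cases "m s"; cases "m t"; cases "m x"; cases "m y"; simp)
      then show ?thesis
        using st(1,2) \<open>x < N\<close> \<open>y < N\<close>
        unfolding ij(4) A_def[symmetric] st(3,4) by (simp add: split_dist_compl inX mem)
    qed
    then have "(\<Sum>S\<in>\<S>. \<omega> S * (split_dist S v (\<pi> ! y) - split_dist S u (\<pi> ! y)))
        \<le> (\<Sum>S\<in>\<S>. \<omega> S * (split_dist S v (\<pi> ! x) - split_dist S u (\<pi> ! x)))"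
      using w by (intro sum_mono mult_left_mono) auto
    then show ?thesis
      unfolding f_def weighted_dist_def by (simp add: right_diff_distrib sum_subtractf)
  qed
  have mem: "\<pi> ! l \<in> closer_set X (weighted_dist \<S> \<omega>) u v \<longleftrightarrow> f l > 0" if "l < N" for l
    using that X len N_def unfolding closer_set_def f_def by auto
  show ?thesis
    unfolding noncrossing_def
  proof (intro allI impI, elim conjE)
    fix a b c d assume abcd: "a < b" "b < c" "c < d" "d < length \<pi>"
    then have lt: "a < N" "b < N" "c < N" "d < N" using len N_def by auto
    have "(f a \<le> f b \<or> f c \<le> f b \<or> f a \<le> f d \<or> f c \<le> f d) \<and>
          (f b \<le> f a \<or> f d \<le> f a \<or> f b \<le> f c \<or> f d \<le> f c)"
      using toward_alternating[OF abcd(1-3) st(5)] mono lt by blast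
    then show "\<not> ((\<pi> ! a \<in> closer_set X (weighted_dist \<S> \<omega>) u v) = (\<pi> ! c \<in> closer_set X (weighted_dist \<S> \<omega>) u v) \<and>
      (\<pi> ! b \<in> closer_set X (weighted_dist \<S> \<omega>) u v) = (\<pi> ! d \<in> closer_set X (weighted_dist \<S> \<omega>) u v) \<and>
      (\<pi> ! a \<in> closer_set X (weighted_dist \<S> \<omega>) u v) = (\<pi> ! b \<notin> closer_set X (weighted_dist \<S> \<omega>) u v))"
      unfolding mem[OF lt(1)] mem[OF lt(2)] mem[OF lt(3)] mem[OF lt(4)] by linarith
  qed
qed

text \<open>Every proper non-empty closer set is non-crossing and so gives a split of the system.
  Grouping the ordered pairs by that split yields the new weight: \<open>p / 2\<close> times the
  size of the group.\<close>

lemma orderly_circular_splits: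
  assumes fin: "finite X" and ord: "is_ordering X \<pi>"
  shows "orderly X (circular_splits X \<pi>)"
  unfolding orderly_def
proof (intro allI impI, elim conjE)
  fix p q :: real and \<omega> :: "'a set set \<Rightarrow> real"
  assume q: "q = p / 2" and p: "0 < p / 2" and w: "\<forall>S\<in>circular_splits X \<pi>. 0 \<le> \<omega> S"
  let ?\<S> = "circular_splits X \<pi>"
  define C where "C = closer_set X (weighted_dist ?\<S> \<omega>)"
  define I where "I = {(u, v). u \<in> X \<and> v \<in> X \<and> u \<noteq> v \<and> {} \<subset> C u v \<and> C u v \<subset> X}"
  define F where "F = (\<lambda>(u, v). {C u v, X - C u v})"
  define \<omega>' where "\<omega>' S = p / 2 * real (card {e \<in> I. F e = S})" for S
  have finI: "finite I"
    unfolding I_def by (rule finite_subset[of _ "X \<times> X"]) (use fin in auto)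
  have FI: "F ` I \<subseteq> ?\<S>"
    using noncrossing_circular_split[OF ord noncrossing_closer_set[OF ord subset_refl w]]
    unfolding F_def I_def C_def by auto
  have "order_dist X p q (weighted_dist ?\<S> \<omega>) x y = weighted_dist ?\<S> \<omega>' x y" for x y
  proof -
    have "order_dist X p q (weighted_dist ?\<S> \<omega>) x y = (\<Sum>e\<in>I. p / 2 * split_dist (F e) x y)"
      unfolding order_dist_half[OF q] I_def C_def F_def by (intro sum.cong) auto
    also have "\<dots> = (\<Sum>S\<in>?\<S>. \<Sum>e\<in>{e \<in> I. F e = S}. p / 2 * split_dist (F e) x y)"
      by (rule sum.group[symmetric, OF finI card_circular_splits(1) FI])
    also have "\<dots> = weighted_dist ?\<S> \<omega>' x y"
      unfolding weighted_dist_def \<omega>'_def by (intro sum.cong) auto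
    finally show ?thesis .
  qed
  moreover have "\<forall>S\<in>?\<S>. 0 \<le> \<omega>' S" using p unfolding \<omega>'_def by auto
  ultimately show "\<exists>\<omega>'. (\<forall>S\<in>?\<S>. 0 \<le> \<omega>' S) \<and> (\<forall>x\<in>X. \<forall>y\<in>X. order_dist X p q (weighted_dist ?\<S> \<omega>) x y = weighted_dist ?\<S> \<omega>' x y)"
    by blast
qed

section \<open>Sweeps\<close>

text \<open>\<open>D\<close> has the four classes \<open>P, Q, {b}, {c}\<close>, and \<open>P\<close> and \<open>Q\<close> are each cut off by \<open>|P| |Q| > 1\<close>
  ordered pairs, but \<open>{b}\<close> and \<open>{c}\<close> by a single one.\<close>

lemma crossing_splits_violation:
  fixes X P Q :: "'a set" and b c :: 'a
  defines "D \<equiv> \<lambda>x y. split_dist {P \<union> {b}, X - (P \<union> {b})} x y + split_dist {P \<union> {c}, X - (P \<union> {c})} x y"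
  assumes fin: "finite X" and card: "card X \<ge> 5" and X: "X = P \<union> Q \<union> {b, c}"
    and disj: "P \<inter> Q = {}" "b \<notin> P \<union> Q" "c \<notin> P \<union> Q" "b \<noteq> c" and d: "d \<in> P" and a: "a \<in> Q"
  shows "order_dist X 2 1 D b a + order_dist X 2 1 D b c < order_dist X 2 1 D a d + order_dist X 2 1 D d c"
proof -
  define C where "C = closer_set X D"
  define I where "I = {(u, v). u \<in> X \<and> v \<in> X \<and> u \<noteq> v \<and> {} \<subset> C u v \<and> C u v \<subset> X}"
  define h where "h e = (of_bool ((b \<in> C (fst e) (snd e)) \<noteq> (a \<in> C (fst e) (snd e)))
      + of_bool ((b \<in> C (fst e) (snd e)) \<noteq> (c \<in> C (fst e) (snd e)))
      - of_bool ((a \<in> C (fst e) (snd e)) \<noteq> (d \<in> C (fst e) (snd e)))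
      - of_bool ((d \<in> C (fst e) (snd e)) \<noteq> (c \<in> C (fst e) (snd e))) :: real)" for e
  have mem: "a \<in> X" "b \<in> X" "c \<in> X" "d \<in> X" using X a d by auto
  have I_sub: "I \<subseteq> X \<times> X" unfolding I_def by auto
  have "order_dist X 2 1 D x y = (\<Sum>(u, v)\<in>I. split_dist {C u v, X - C u v} x y)" for x y
    by (subst order_dist_half) (simp_all add: I_def C_def)
  then have "order_dist X 2 1 D x y = (\<Sum>(u, v)\<in>I. of_bool ((x \<in> C u v) \<noteq> (y \<in> C u v)))"
    if "x \<in> X" "y \<in> X" for x y
    using split_dist_compl[OF that] by simp
  then have "order_dist X 2 1 D b a + order_dist X 2 1 D b c - order_dist X 2 1 D a d - order_dist X 2 1 D d c
     = (\<Sum>e\<in>I. h e)"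
    using mem unfolding h_def by (simp add: sum.distrib sum_subtractf case_prod_unfold)
  \<comment> \<open>A closer set that is empty or all of \<open>X\<close> separates no points, so
    the sum may run over all pairs.\<close>
  also have "\<dots> = (\<Sum>e\<in>X \<times> X. h e)"
  proof (rule sum.mono_neutral_left)
    show "\<forall>e\<in>X \<times> X - I. h e = 0"
    proof
      fix e assume e: "e \<in> X \<times> X - I"
      obtain u v where uv: "e = (u, v)" by (cases e)
      have "C u u = {}" unfolding C_def closer_set_def by auto
      moreover have "C u v \<subseteq> X" unfolding C_def closer_set_def by auto
      ultimately have "C u v = {} \<or> C u v = X" using e unfolding uv I_def by auto
      then show "h e = 0" using mem unfolding h_def uv by auto
    qed
  qed (use fin I_sub in auto)
  \<comment> \<open>The closer set of \<open>(b, c)\<close> is \<open>{b}\<close>, which contributes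
    2; that of a pair in \<open>P \<times> Q\<close> is \<open>P\<close>, which contributes -2. For
    all other ordered pairs the four terms cancel.\<close>
  also have "\<dots> = (\<Sum>e\<in>X \<times> X. 2 * of_bool (e \<in> {(b, c)}) - 2 * of_bool (e \<in> P \<times> Q))"
  proof (rule sum.cong[OF refl])
    fix e assume e: "e \<in> X \<times> X"
    obtain u v where uv: "e = (u, v)" by (cases e)
    have uvX: "u \<in> X" "v \<in> X" using e uv by auto
    have C: "x \<in> C u v \<longleftrightarrow>
        of_bool ((u \<in> P \<union> {b}) \<noteq> (x \<in> P \<union> {b})) + of_bool ((u \<in> P \<union> {c}) \<noteq> (x \<in> P \<union> {c}))
        < (of_bool ((v \<in> P \<union> {b}) \<noteq> (x \<in> P \<union> {b})) + of_bool ((v \<in> P \<union> {c}) \<noteq> (x \<in> P \<union> {c})) :: real)"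
      if "x \<in> X" for x
      using that uvX unfolding C_def closer_set_def D_def by (simp add: split_dist_compl)
    have q: "a \<notin> P" "a \<noteq> b" "a \<noteq> c" "d \<noteq> b" "d \<noteq> c" "b \<notin> P" "c \<notin> P" "b \<noteq> c" "c \<noteq> b"
      using disj a d by auto
    have u: "u \<in> P \<and> u \<noteq> b \<and> u \<noteq> c \<and> u \<notin> Q \<or> u = b \<or> u = c \<or> u \<in> Q \<and> u \<notin> P \<and> u \<noteq> b \<and> u \<noteq> c"
      and v: "v \<in> P \<and> v \<noteq> b \<and> v \<noteq> c \<and> v \<notin> Q \<or> v = b \<or> v = c \<or> v \<in> Q \<and> v \<notin> P \<and> v \<noteq> b \<and> v \<noteq> c"
      using uvX X disj by auto
    from u v show "h e = 2 * of_bool (e \<in> {(b, c)}) - 2 * of_bool (e \<in> P \<times> Q)"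
      unfolding h_def uv fst_conv snd_conv C[OF mem(1)] C[OF mem(2)] C[OF mem(3)] C[OF mem(4)]
      by (elim disjE conjE) (use q d disj in simp_all)
  qed
  also have "\<dots> = 2 - 2 * real (card (P \<times> Q))"
  proof -
    have count: "(\<Sum>e\<in>X \<times> X. of_bool (e \<in> B)) = real (card B)" if "B \<subseteq> X \<times> X" for B
    proof -
      have "(\<Sum>e\<in>X \<times> X. of_bool (e \<in> B)) = (\<Sum>e\<in>B. 1 :: real)"
        by (rule sum.mono_neutral_cong_right) (use fin that in auto)
      then show ?thesis by simp
    qed
    have sub: "{(b, c)} \<subseteq> X \<times> X" "P \<times> Q \<subseteq> X \<times> X" using X by auto
    show ?thesis
      unfolding sum_subtractf sum_distrib_left[symmetric] count[OF sub(1)] count[OF sub(2)] by simp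
  qed
  \<comment> \<open>Five elements leave at least three for \<open>P\<close> and \<open>Q\<close>
    together, whence the product of their sizes is at least 2.\<close>
  also have "\<dots> < 0"
  proof -
    have finPQ: "finite P" "finite Q" using fin X by auto
    have "card X = card P + card Q + 2"
      unfolding X using disj finPQ by (simp add: card_Un_disjoint card_insert_if)
    moreover have "card P \<ge> 1" "card Q \<ge> 1"
      using finPQ a d by (auto simp: Suc_le_eq card_gt_0_iff)
    moreover have "card P * card Q \<ge> card P + card Q - 1" if "card P \<ge> 1" "card Q \<ge> 1"
      using that by (cases "card P"; cases "card Q") auto
    ultimately have "card (P \<times> Q) \<ge> 2" using card by (simp add: card_cartesian_product)
    then show ?thesis by simp
  qed
  finally show ?thesis by simp
qed

section \<open>Sweeps and the turns of a single element\<close>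

text \<open>\<open>R t\<close> is the order of \<open>X\<close> at time \<open>t\<close>; the pair \<open>{x, y}\<close> is reversed by the step from time
  \<open>T {x, y}\<close> to time \<open>T {x, y} + 1\<close> and by no other step.\<close>

locale sweep =
  fixes X :: "'a set" and R :: "nat \<Rightarrow> 'a \<Rightarrow> 'a \<Rightarrow> bool" and m :: nat and T :: "'a set \<Rightarrow> nat"
  assumes fin: "finite X"
    and irrefl: "t \<le> m \<Longrightarrow> \<not> R t x x"
    and trans: "t \<le> m \<Longrightarrow> R t x y \<Longrightarrow> R t y z \<Longrightarrow> R t x z"
    and total: "t \<le> m \<Longrightarrow> x \<in> X \<Longrightarrow> y \<in> X \<Longrightarrow> x \<noteq> y \<Longrightarrow> R t x y \<or> R t y x"
    and T_less: "x \<in> X \<Longrightarrow> y \<in> X \<Longrightarrow> x \<noteq> y \<Longrightarrow> T {x, y} < m"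
    and T_inj: "x \<in> X \<Longrightarrow> y \<in> X \<Longrightarrow> x \<noteq> y \<Longrightarrow> u \<in> X \<Longrightarrow> v \<in> X \<Longrightarrow> u \<noteq> v \<Longrightarrow>
      T {x, y} = T {u, v} \<Longrightarrow> {x, y} = {u, v}"
    and flip: "t \<le> m \<Longrightarrow> x \<in> X \<Longrightarrow> y \<in> X \<Longrightarrow> x \<noteq> y \<Longrightarrow> R t x y \<longleftrightarrow> (R 0 x y \<longleftrightarrow> t \<le> T {x, y})"
begin

definition initial :: "nat \<Rightarrow> 'a set \<Rightarrow> bool" where
  "initial t A \<longleftrightarrow> A \<subseteq> X \<and> (\<forall>x\<in>A. \<forall>y\<in>X. R t y x \<longrightarrow> y \<in> A)"

text \<open>In an arrangement of pseudolines, one for each element of \<open>X\<close>, an initial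
  segment records the lines above a cell. Passing to unordered splits identifies opposite unbounded
  cells.\<close>

definition cells :: "'a set set set" where
  "cells = {{A, X - A} | A t. t \<le> m \<and> initial t A \<and> A \<noteq> {} \<and> A \<noteq> X}"

text \<open>Read \<open>R t x y\<close> as \<open>x\<close> lying above \<open>y\<close>: elements
  \<open>c\<close> are those that \<open>d\<close> overtakes by rising, elements \<open>b\<close>
  those below which it falls. An element at the top or bottom at time 0 has both this property and
  \<open>falls_first\<close>.\<close>

definition rises_first :: "'a \<Rightarrow> bool" where
  "rises_first d \<longleftrightarrow> (\<forall>b\<in>X. \<forall>c\<in>X. R 0 d b \<and> R 0 c d \<longrightarrow> T {c, d} < T {d, b})"

definition falls_first :: "'a \<Rightarrow> bool" where
  "falls_first d \<longleftrightarrow> (\<forall>b\<in>X. \<forall>c\<in>X. R 0 d b \<and> R 0 c d \<longrightarrow> T {d, b} < T {c, d})"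

lemma asym: "t \<le> m \<Longrightarrow> R t x y \<Longrightarrow> \<not> R t y x"
  using irrefl trans by blast

lemma finite_cells: "finite cells"
  by (rule finite_subset[of _ "Pow (Pow X)"]) (auto simp: cells_def initial_def fin)

text \<open>Suppose that \<open>d\<close> first falls below \<open>b\<close> and next rises above \<open>c\<close>, with \<open>a\<close> below it in between.
  Let \<open>P\<close> consist of \<open>d\<close> and the elements above it other than \<open>b, c\<close>, and let \<open>Q\<close> be the set below \<open>d\<close>.
  Then \<open>P + b | Q + c\<close> and \<open>P + c | Q + b\<close> are cells, while no cell separates \<open>d\<close> from all of
  \<open>a, b, c\<close>, so that distances from cells satisfy \<open>D a d + D d c \<le> D b a + D b c\<close>.\<close>

lemma last_at_turn:
  assumes ord: "orderly X cells" and card: "card X \<ge> 5"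
    and X: "b \<in> X" "c \<in> X" "d \<in> X" and db: "R 0 d b" and cd: "R 0 c d"
    and lt: "T {d, b} < T {c, d}"
    and consec: "\<And>e. e \<in> X \<Longrightarrow> e \<noteq> d \<Longrightarrow> T {d, b} < T {d, e} \<Longrightarrow> T {d, e} < T {c, d} \<Longrightarrow> False"
    and a: "a \<in> X"
  shows "\<not> R (Suc (T {d, b})) d a"
proof
  define t1 where "t1 = T {d, b}"
  define t2 where "t2 = T {c, d}"
  define t where "t = Suc t1"
  assume "R (Suc (T {d, b})) d a"
  then have da: "R t d a" unfolding t_def t1_def .
  have neq: "d \<noteq> b" "c \<noteq> d" "b \<noteq> c" using db cd irrefl[of 0] asym[of 0 c d] by auto
  have t2m: "t2 < m" unfolding t2_def using T_less[OF X(2,3) neq(2)] .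
  have t12: "t1 < t2" using lt unfolding t1_def t2_def .
  have le: "t1 \<le> m" "t2 \<le> m" "t \<le> m" "Suc t2 \<le> m" using t2m t12 unfolding t_def by auto
  \<comment> \<open>No third element passes \<open>d\<close> between the two turns. Hence, apart
    from \<open>b\<close> and \<open>c\<close>, the elements above \<open>d\<close> stay the same
    from time \<open>t1\<close> to time \<open>Suc t2\<close>.\<close>
  have Tother: "T {x, d} < t1 \<or> t2 < T {x, d}" if "x \<in> X" "x \<noteq> d" "x \<noteq> b" "x \<noteq> c" for x
  proof -
    have "T {x, d} \<noteq> t1" "T {x, d} \<noteq> t2"
      using T_inj[of x d d b] T_inj[of x d c d] that X neq unfolding t1_def t2_def
      by (auto simp: doubleton_eq_iff)
    moreover have "\<not> (t1 < T {x, d} \<and> T {x, d} < t2)"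
      using consec[OF that(1,2)] unfolding t1_def t2_def by (auto simp: insert_commute)
    ultimately show ?thesis by linarith
  qed
  have Rother: "R s x d \<longleftrightarrow> R t x d" "R s d x \<longleftrightarrow> R t d x"
    if "x \<in> X" "x \<noteq> d" "x \<noteq> b" "x \<noteq> c" "t1 \<le> s" "s \<le> Suc t2" for s x
  proof -
    have sm: "s \<le> m" using that(6) le by simp
    have "s \<le> T {x, d} \<longleftrightarrow> t \<le> T {x, d}"
      using Tother[OF that(1-4)] that(5,6) t12 unfolding t_def by linarith
    then show "R s x d \<longleftrightarrow> R t x d" "R s d x \<longleftrightarrow> R t d x"
      using flip[OF sm that(1) X(3) that(2)] flip[OF le(3) that(1) X(3) that(2)]
        flip[OF sm X(3) that(1)] flip[OF le(3) X(3) that(1)] that(2) by (auto simp: insert_commute)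
  qed
  \<comment> \<open>A reversal time is the last time of the old order: at \<open>t1\<close> the
    element \<open>d\<close> is still above \<open>b\<close>, at \<open>t2\<close> still below
    \<open>c\<close>.\<close>
  have Rdb: "R s d b \<longleftrightarrow> s \<le> t1" and Rcd: "R s c d \<longleftrightarrow> s \<le> t2"
    and Rbd: "R s b d \<longleftrightarrow> t1 < s" and Rdc: "R s d c \<longleftrightarrow> t2 < s" if "s \<le> m" for s
    using flip[OF that, of d b] flip[OF that, of c d] flip[OF that, of b d] flip[OF that, of d c]
      X neq db cd asym[of 0 d b] asym[of 0 c d] unfolding t1_def t2_def by (auto simp: insert_commute)
  define P where "P = {x \<in> X. x = d \<or> R t x d \<and> x \<noteq> b \<and> x \<noteq> c}"
  define Q where "Q = {x \<in> X. R t d x}"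
  have XPQ: "X = P \<union> Q \<union> {b, c}"
    using total[OF le(3) _ X(3)] X unfolding P_def Q_def by auto
  have disj: "P \<inter> Q = {}" "b \<notin> P \<union> Q" "c \<notin> P \<union> Q"
    using asym[OF le(3), of d] irrefl[OF le(3)] neq Rdb[OF le(3)] Rdc[OF le(3)] t12
    unfolding P_def Q_def t_def by auto
  have aQ: "a \<in> Q" and dP: "d \<in> P" using a da X unfolding P_def Q_def by auto
  have aneq: "a \<noteq> b" "a \<noteq> c" "a \<noteq> d" using aQ dP disj by auto
  \<comment> \<open>After the second turn \<open>b\<close> is above \<open>d\<close> and
    \<open>c\<close> below it, so the segment ending in \<open>d\<close> is
    \<open>P \<union> {b}\<close>. Before the first turn the roles of \<open>b\<close> and
    \<open>c\<close> are exchanged.\<close>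
  have "initial (Suc t2) (P \<union> {b})"
    unfolding initial_def
  proof (intro conjI ballI impI)
    fix x y assume x: "x \<in> P \<union> {b}" and y: "y \<in> X" and yx: "R (Suc t2) y x"
    have "x = d \<or> R (Suc t2) x d"
      using x Rother(1)[of x "Suc t2"] Rbd[OF le(4)] t12 unfolding P_def by auto
    then have yd: "R (Suc t2) y d" using yx trans[OF le(4)] by blast
    then have "y \<noteq> c" "y \<noteq> d" using Rcd[OF le(4)] irrefl[OF le(4)] by auto
    then show "y \<in> P \<union> {b}"
      using Rother(1)[of y "Suc t2"] yd y t12 unfolding P_def by auto
  qed (use XPQ in auto)
  moreover have "initial t1 (P \<union> {c})"
    unfolding initial_def
  proof (intro conjI ballI impI)
    fix x y assume x: "x \<in> P \<union> {c}" and y: "y \<in> X" and yx: "R t1 y x"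
    have "x = d \<or> R t1 x d"
      using x Rother(1)[of x t1] Rcd[OF le(1)] t12 unfolding P_def by auto
    then have yd: "R t1 y d" using yx trans[OF le(1)] by blast
    then have "y \<noteq> b" "y \<noteq> d" using Rbd[OF le(1)] irrefl[OF le(1)] by auto
    then show "y \<in> P \<union> {c}"
      using Rother(1)[of y t1] yd y t12 unfolding P_def by auto
  qed (use XPQ in auto)
  moreover have proper: "P \<union> {b} \<noteq> X" "P \<union> {c} \<noteq> X" using X neq disj by auto
  ultimately have cells: "{P \<union> {b}, X - (P \<union> {b})} \<in> cells" "{P \<union> {c}, X - (P \<union> {c})} \<in> cells"
    using le unfolding cells_def by blast+
  define S1 where "S1 = {P \<union> {b}, X - (P \<union> {b})}"
  define S2 where "S2 = {P \<union> {c}, X - (P \<union> {c})}"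
  have "S1 \<noteq> S2"
    using neq disj dP unfolding S1_def S2_def by (auto simp: doubleton_eq_iff)
  define D where "D = weighted_dist cells (\<lambda>S. of_bool (S \<in> {S1, S2}))"
  have "D x y = split_dist S1 x y + split_dist S2 x y" for x y
  proof -
    have "D x y = (\<Sum>S\<in>{S1, S2}. split_dist S x y)"
      unfolding D_def weighted_dist_def
      by (rule sum.mono_neutral_cong_right) (use finite_cells cells in \<open>auto simp: S1_def S2_def\<close>)
    then show ?thesis using \<open>S1 \<noteq> S2\<close> by simp
  qed
  then have D: "D = (\<lambda>x y. split_dist S1 x y + split_dist S2 x y)" by blast
  \<comment> \<open>With \<open>p = 2\<close> and \<open>q = 1\<close> every ordered pair counts
    with weight one.\<close>
  have "\<exists>\<omega>'. (\<forall>S\<in>cells. 0 \<le> \<omega>' S) \<and> (\<forall>x\<in>X. \<forall>y\<in>X. order_dist X 2 1 D x y = weighted_dist cells \<omega>' x y)"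
    using ord unfolding orderly_def D_def by (elim allE[of _ 2] allE[of _ 1]) auto
  then obtain \<omega>' where w: "\<And>S. S \<in> cells \<Longrightarrow> 0 \<le> \<omega>' S"
    and O: "\<And>x y. x \<in> X \<Longrightarrow> y \<in> X \<Longrightarrow> order_dist X 2 1 D x y = weighted_dist cells \<omega>' x y"
    by blast
  have "split_dist S a d + split_dist S d c \<le> split_dist S b a + split_dist S b c" if S: "S \<in> cells" for S
  proof -
    obtain s A where A: "S = {A, X - A}" "s \<le> m" "initial s A"
      using S unfolding cells_def by blast
    \<comment> \<open>Separating \<open>d\<close> from all of \<open>a, b, c\<close> is the only way
      to violate the inequality. With \<open>d\<close> alone inside, \<open>b\<close> and
      \<open>c\<close> would require \<open>s \<le> t1\<close> and \<open>t2 < s\<close>. With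
      \<open>d\<close> alone outside, they force \<open>t1 < s \<le> t2\<close>, when
      \<open>a\<close> is below \<open>d\<close>.\<close>
    have "\<not> (d \<in> A \<and> a \<notin> A \<and> b \<notin> A \<and> c \<notin> A)"
    proof
      assume "d \<in> A \<and> a \<notin> A \<and> b \<notin> A \<and> c \<notin> A"
      then have "\<not> R s b d" "\<not> R s c d" using A(3) X unfolding initial_def by auto
      then show False using Rbd[OF A(2)] Rcd[OF A(2)] t12 by auto
    qed
    moreover have "\<not> (d \<notin> A \<and> a \<in> A \<and> b \<in> A \<and> c \<in> A)"
    proof
      assume "d \<notin> A \<and> a \<in> A \<and> b \<in> A \<and> c \<in> A"
      then have n: "\<not> R s d a" "\<not> R s d b" "\<not> R s d c" using A(3) X unfolding initial_def by auto
      then have "t1 \<le> s" "s \<le> t2" using Rdb[OF A(2)] Rdc[OF A(2)] by auto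
      then show False using Rother(2)[of a s] a aneq da n by auto
    qed
    ultimately show ?thesis
      using a X unfolding A(1) by (auto simp: split_dist_compl)
  qed
  then have "(\<Sum>S\<in>cells. \<omega>' S * (split_dist S a d + split_dist S d c))
      \<le> (\<Sum>S\<in>cells. \<omega>' S * (split_dist S b a + split_dist S b c))"
    using w by (intro sum_mono mult_left_mono) auto
  then have "order_dist X 2 1 D a d + order_dist X 2 1 D d c \<le> order_dist X 2 1 D b a + order_dist X 2 1 D b c"
    using a X by (simp add: O weighted_dist_def distrib_left sum.distrib)
  with crossing_splits_violation[OF fin card XPQ disj neq(3) dP aQ] show False
    unfolding D S1_def S2_def by simp
qed

text \<open>If \<open>d\<close> falls below some \<open>b\<close> before rising above some
  \<open>c\<close>, choose such a pair with the smallest time gap; no other passing of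
  \<open>d\<close> lies in between. By \<open>last_at_turn\<close>, \<open>d\<close> is then at the
  very bottom after falling below \<open>b\<close>: all its falls are done and all its rises are
  still to come.\<close>

lemma rises_or_falls_first:
  assumes ord: "orderly X cells" and card: "card X \<ge> 5" and d: "d \<in> X"
  shows "rises_first d \<or> falls_first d"
proof (rule disjCI)
  assume "\<not> falls_first d"
  show "rises_first d"
  proof (rule ccontr)
    assume "\<not> rises_first d"
    define G where "G e \<longleftrightarrow> fst e \<in> X \<and> snd e \<in> X \<and> R 0 d (fst e) \<and> R 0 (snd e) d \<and> T {d, fst e} < T {snd e, d}" for e
    obtain b0 c0 where bc0: "b0 \<in> X" "c0 \<in> X" "R 0 d b0" "R 0 c0 d" "\<not> T {c0, d} < T {d, b0}"
      using \<open>\<not> rises_first d\<close> unfolding rises_first_def by blast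
    moreover have "d \<noteq> b0" "c0 \<noteq> d" "b0 \<noteq> c0" using bc0 irrefl[of 0] asym[of 0 c0 d] by auto
    ultimately have "T {c0, d} \<noteq> T {d, b0}"
      using T_inj[of c0 d d b0] d by (auto simp: doubleton_eq_iff)
    then have "G (b0, c0)" using bc0 unfolding G_def by auto
    then obtain e where e: "G e" "\<And>e'. G e' \<Longrightarrow> T {snd e, d} - T {d, fst e} \<le> T {snd e', d} - T {d, fst e'}"
      using ex_has_least_nat[of G _ "\<lambda>e. T {snd e, d} - T {d, fst e}"] by blast
    obtain b c where bc: "e = (b, c)" by (cases e)
    have *: "b \<in> X" "c \<in> X" "R 0 d b" "R 0 c d" "T {d, b} < T {c, d}"
      using e(1) unfolding G_def bc by auto
    have neq: "d \<noteq> b" "c \<noteq> d" using * irrefl[of 0] by auto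
    define t where "t = Suc (T {d, b})"
    have tm: "t \<le> m" using T_less[OF d *(1) neq(1)] unfolding t_def by simp
    have last: "\<not> R t d a" if "a \<in> X" for a
      unfolding t_def
    proof (rule last_at_turn[OF ord card *(1,2) d *(3-5) _ that])
      fix f assume f: "f \<in> X" "f \<noteq> d" "T {d, b} < T {d, f}" "T {d, f} < T {c, d}"
      then consider "R 0 d f" | "R 0 f d" using total[of 0 d f] d by auto
      then show False
      proof cases
        case 1
        then have "G (f, c)" using f * unfolding G_def by auto
        from e(2)[OF this] show False using f by (simp add: bc)
      next
        case 2
        then have "G (b, f)" using f * unfolding G_def by (auto simp: insert_commute)
        from e(2)[OF this] show False using f by (simp add: bc insert_commute)
      qed
    qed
    have "falls_first d"
      unfolding falls_first_def
    proof (intro ballI impI, elim conjE)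
      fix b' c' assume bc': "b' \<in> X" "c' \<in> X" "R 0 d b'" "R 0 c' d"
      then have "d \<noteq> b'" "d \<noteq> c'" using irrefl[of 0] by auto
      then have "\<not> t \<le> T {d, b'}" "t \<le> T {d, c'}"
        using flip[OF tm d, of b'] flip[OF tm d, of c'] last[OF bc'(1)] last[OF bc'(2)] bc' asym[of 0 c' d] by auto
      then show "T {d, b'} < T {c', d}" by (simp add: insert_commute)
    qed
    with \<open>\<not> falls_first d\<close> show False ..
  qed
qed

section \<open>The circular ordering obtained from rising and falling elements\<close>

text \<open>If \<open>y\<close> were missing from \<open>A\<close>, at time \<open>t\<close> it
  would lie below both \<open>x\<close> and \<open>z\<close>: already fallen below \<open>z\<close>,
  but not yet risen above \<open>x\<close>.\<close>

lemma rises_first_convex: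
  assumes t: "t \<le> m" and A: "initial t A" and X: "x \<in> X" "y \<in> X" "z \<in> X"
    and R: "R 0 x y" "R 0 y z" and y: "rises_first y" and mem: "x \<in> A" "z \<in> A"
  shows "y \<in> A"
proof (rule ccontr)
  assume "y \<notin> A"
  then have "\<not> R t y x" "\<not> R t y z" using A X mem unfolding initial_def by auto
  moreover have "x \<noteq> y" "y \<noteq> z" using R irrefl[of 0] by auto
  ultimately have "t \<le> T {x, y}" "\<not> t \<le> T {y, z}"
    using flip[OF t, of y x] flip[OF t, of y z] X R asym[of 0 x y] asym[of 0 y z] by (auto simp: insert_commute)
  moreover have "T {x, y} < T {y, z}" using y X R unfolding rises_first_def by blast
  ultimately show False by simp
qed

text \<open>Dually, a \<open>y\<close> in \<open>A\<close> would lie above both \<open>x\<close> and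
  \<open>z\<close>: already risen above \<open>x\<close>, but not yet fallen below
  \<open>z\<close>.\<close>

lemma falls_first_convex:
  assumes t: "t \<le> m" and A: "initial t A" and X: "x \<in> X" "y \<in> X" "z \<in> X"
    and R: "R 0 x y" "R 0 y z" and y: "falls_first y" and mem: "x \<notin> A" "z \<notin> A"
  shows "y \<notin> A"
proof
  assume "y \<in> A"
  then have "\<not> R t x y" "\<not> R t z y" using A X mem unfolding initial_def by auto
  moreover have "x \<noteq> y" "y \<noteq> z" using R irrefl[of 0] by auto
  ultimately have "\<not> t \<le> T {x, y}" "t \<le> T {y, z}"
    using flip[OF t, of x y] flip[OF t, of z y] X R asym[of 0 x y] asym[of 0 y z] by (auto simp: insert_commute)
  moreover have "T {y, z} < T {x, y}" using y X R unfolding falls_first_def by blast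
  ultimately show False by simp
qed

theorem orderly_imp_circular:
  assumes ord: "orderly X cells" and card: "card X \<ge> 5"
  shows "circular X cells"
proof -
  define r where "r x = card {y \<in> X. R 0 y x}" for x
  have r_less: "r x < r y" if "x \<in> X" "y \<in> X" "R 0 x y" for x y
  proof -
    have "{z \<in> X. R 0 z x} \<subset> {z \<in> X. R 0 z y}"
      using that irrefl[of 0] trans[of 0 _ x y] by auto
    then show ?thesis unfolding r_def using fin by (intro psubset_card_mono) auto
  qed
  have r_iff: "R 0 x y \<longleftrightarrow> r x < r y" if "x \<in> X" "y \<in> X" for x y
    using that r_less total[of 0 x y] irrefl[of 0] by (metis less_asym' le0 less_irrefl)
  have r_le: "r x < card X" if "x \<in> X" for x
    unfolding r_def using fin that irrefl[of 0] by (intro psubset_card_mono) auto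
  txt \<open>The elements that rise first in their original order, followed by the others in reverse.\<close>
  define k where "k x = (if rises_first x then r x else 2 * card X - r x)" for x
  \<comment> \<open>Ranks \<open>r x\<close> are below \<open>card X\<close>, so the reflected
    values exceed \<open>card X\<close> and cannot collide with the unreflected ones.\<close>
  have k_inj: "inj_on k X"
  proof (rule inj_onI)
    fix x y assume xy: "x \<in> X" "y \<in> X" "k x = k y"
    then have "r x = r y" using r_le[of x] r_le[of y] unfolding k_def by (auto split: if_splits)
    then show "x = y" using r_less[of x y] r_less[of y x] total[of 0 x y] xy by auto
  qed
  define \<pi> where "\<pi> = map (the_inv_into X k) (sorted_list_of_set (k ` X))"
  have set\<pi>: "set \<pi> = X"
    unfolding \<pi>_def using fin k_inj by (simp add: image_image the_inv_into_f_f)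
  have k\<pi>: "k (\<pi> ! i) = sorted_list_of_set (k ` X) ! i" if "i < length \<pi>" for i
  proof -
    have "sorted_list_of_set (k ` X) ! i \<in> k ` X"
      using that fin nth_mem[of i "sorted_list_of_set (k ` X)"] unfolding \<pi>_def by auto
    then show ?thesis using that k_inj unfolding \<pi>_def by (simp add: f_the_inv_into_f)
  qed
  have k_less: "k (\<pi> ! i) < k (\<pi> ! j)" if "i < j" "j < length \<pi>" for i j
    using that k\<pi>[of i] k\<pi>[of j] strict_sorted_list_of_set[of "k ` X"] unfolding \<pi>_def
    by (auto simp: sorted_wrt_iff_nth_less)
  have "distinct \<pi>"
    unfolding distinct_conv_nth using k_less by (metis less_irrefl nat_neq_iff)
  then have ordering: "is_ordering X \<pi>" using set\<pi> unfolding is_ordering_def by simp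
  have "S \<in> circular_splits X \<pi>" if S: "S \<in> cells" for S
  proof -
    obtain A t where A: "S = {A, X - A}" "t \<le> m" "initial t A" "A \<noteq> {}" "A \<noteq> X"
      using S unfolding cells_def by blast
    \<comment> \<open>Convexity in terms of the rank at time 0; an element that does not rise first
      falls first, so one of the two rules applies to every \<open>y\<close>.\<close>
    have up: "y \<in> A" if "x \<in> X" "y \<in> X" "z \<in> X" "r x < r y" "r y < r z" "rises_first y" "x \<in> A" "z \<in> A" for x y z
      using rises_first_convex[OF A(2,3)] that r_iff by blast
    have down: "y \<notin> A" if "x \<in> X" "y \<in> X" "z \<in> X" "r x < r y" "r y < r z" "\<not> rises_first y" "x \<notin> A" "z \<notin> A" for x y z
      using falls_first_convex[OF A(2,3)] that r_iff rises_or_falls_first[OF ord card] by blast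
    have "noncrossing \<pi> A"
      unfolding noncrossing_def
    proof (intro allI impI, elim conjE)
      fix a b c d assume abcd: "a < b" "b < c" "c < d" "d < length \<pi>"
      define w x y z where "w = \<pi> ! a" and "x = \<pi> ! b" and "y = \<pi> ! c" and "z = \<pi> ! d"
      have X: "w \<in> X" "x \<in> X" "y \<in> X" "z \<in> X"
        unfolding w_def x_def y_def z_def set\<pi>[symmetric] using abcd by auto
      have lt: "k w < k x" "k x < k y" "k y < k z"
        unfolding w_def x_def y_def z_def using abcd k_less by auto
      have lt2: "k w < k y" "k w < k z" "k x < k z" using lt by auto
      \<comment> \<open>In the order by \<open>k\<close>, elements that rise first come first and
        with increasing rank (\<open>RR\<close>, \<open>UU\<close>); rank decreases along the rest
        (\<open>LL\<close>).\<close>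
      have UU: "r u < r v" if "k u < k v" "rises_first v" "u \<in> X" "v \<in> X" for u v
        using that r_le[of u] r_le[of v] unfolding k_def by (auto split: if_splits)
      have LL: "r v < r u" if "k u < k v" "\<not> rises_first u" "u \<in> X" "v \<in> X" for u v
        using that r_le[of u] r_le[of v] unfolding k_def by (auto split: if_splits)
      have RR: "rises_first u" if "k u < k v" "rises_first v" "u \<in> X" "v \<in> X" for u v
        using that r_le[of u] r_le[of v] unfolding k_def by (auto split: if_splits)
      have ne: "r u \<noteq> r v" if "k u < k v" "u \<in> X" "v \<in> X" for u v
        using r_less[of u v] r_less[of v u] total[of 0 u v] that by (cases "u = v") auto
      \<comment> \<open>Every branch ends with three of the four points whose middle one in rank
        contradicts \<open>up\<close> or \<open>down\<close>.\<close>
      have "\<not> (w \<in> A \<and> x \<notin> A \<and> y \<in> A \<and> z \<notin> A)"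
      proof
        assume *: "w \<in> A \<and> x \<notin> A \<and> y \<in> A \<and> z \<notin> A"
        show False
        proof (cases "rises_first x")
          case True
          then have "\<not> r x < r y" using up[of w x y] UU[of w x] X lt * by blast
          moreover have "\<not> r y < r x \<or> rises_first y" using down[of z y x] LL[of y z] X lt * by blast
          ultimately show False using ne[of x y] UU[of x y] X lt by linarith
        next
          case False
          then have "\<not> rises_first y" using RR lt X by blast
          then show False using down[of z y x] LL[of x y] LL[of y z] False X lt * by blast
        qed
      qed
      moreover have "\<not> (w \<notin> A \<and> x \<in> A \<and> y \<notin> A \<and> z \<in> A)"
      proof
        assume *: "w \<notin> A \<and> x \<in> A \<and> y \<notin> A \<and> z \<in> A"
        show False
        proof (cases "rises_first x")
          case True
          then have w: "rises_first w" "r w < r x" using RR UU X lt by blast+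
          then have wz: "r w < r z" using up[of z w x] ne[of w z] X lt2 * by (meson linorder_neqE_nat)
          then have "\<not> r z < r y \<or> rises_first z" using down[of w z y] X * by blast
          then have yz: "r y < r z" using ne[of y z] UU[of y z] X lt by linarith
          then have "rises_first y" using LL[of y z] X lt by (meson less_asym')
          then show False using up[of x y z] UU[of x y] yz X lt * by blast
        next
          case False
          then have n: "\<not> rises_first y" "\<not> rises_first z" using RR lt X by blast+
          then have r: "r z < r y" "r y < r x" using LL False X lt by blast+
          have "\<not> r w < r z" using down[of w z y] n r X * by blast
          then have zw: "r z < r w" using ne[of w z] X lt2 by linarith
          have "\<not> r x < r w" using down[of y x w] False r X * by blast
          then have "r w < r x" using ne[of w x] X lt by linarith
          moreover from this have "rises_first w" using LL[of w x] X lt by (meson less_asym')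
          ultimately show False using up[of z w x] zw X * by blast
        qed
      qed
      ultimately show "\<not> ((\<pi> ! a \<in> A) = (\<pi> ! c \<in> A) \<and> (\<pi> ! b \<in> A) = (\<pi> ! d \<in> A) \<and> (\<pi> ! a \<in> A) = (\<pi> ! b \<notin> A))"
        unfolding w_def x_def y_def z_def by blast
    qed
    then show ?thesis
      using noncrossing_circular_split[OF ordering] A unfolding A(1) initial_def by auto
  qed
  then show ?thesis
    using ordering unfolding circular_iff_subset by blast
qed

end

section \<open>Allowable sequences\<close>

primrec before :: "'a list \<Rightarrow> 'a \<Rightarrow> 'a \<Rightarrow> bool" where
  "before [] x y \<longleftrightarrow> False"
| "before (z # zs) x y \<longleftrightarrow> z = x \<and> y \<in> set zs \<or> before zs x y"

lemma before_append:
  "before (xs @ ys) x y \<longleftrightarrow> before xs x y \<or> before ys x y \<or> x \<in> set xs \<and> y \<in> set ys"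
  by (induction xs) auto

lemma before_in_set: "before xs x y \<Longrightarrow> x \<in> set xs \<and> y \<in> set xs"
  by (induction xs) auto

lemma before_irrefl: "distinct xs \<Longrightarrow> \<not> before xs x x"
  by (induction xs) auto

lemma before_trans: "distinct xs \<Longrightarrow> before xs x y \<Longrightarrow> before xs y z \<Longrightarrow> before xs x z"
  by (induction xs) (auto dest: before_in_set)

lemma before_total: "x \<in> set xs \<Longrightarrow> y \<in> set xs \<Longrightarrow> x \<noteq> y \<Longrightarrow> before xs x y \<or> before xs y x"
  by (induction xs) auto

lemma before_take:
  assumes "distinct xs" "before xs y x" "x \<in> set (take k xs)"
  shows "y \<in> set (take k xs)"
proof -
  have "before (take k xs @ drop k xs) y x" using assms(2) by simp
  moreover have "x \<notin> set (drop k xs)"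
    using set_take_disj_set_drop_if_distinct[OF assms(1) order_refl] assms(3) by blast
  ultimately show ?thesis
    unfolding before_append by (auto dest: before_in_set)
qed

text \<open>A set closed under predecessors is empty or contains the head; in the latter case remove
  the head and recurse.\<close>

lemma before_closed_imp_take:
  assumes "distinct xs" "A \<subseteq> set xs" "\<And>x y. x \<in> A \<Longrightarrow> before xs y x \<Longrightarrow> y \<in> A"
  shows "\<exists>k. A = set (take k xs)"
  using assms
proof (induction xs arbitrary: A)
  case (Cons z zs)
  show ?case
  proof (cases "z \<in> A")
    case True
    have "\<exists>k. A - {z} = set (take k zs)"
    proof (rule Cons.IH)
      fix x y assume "x \<in> A - {z}" "before zs y x"
      then show "y \<in> A - {z}"
        using Cons.prems(3)[of x y] Cons.prems(1) before_in_set[of zs y x] by auto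
    qed (use Cons.prems in auto)
    then obtain k where "A - {z} = set (take k zs)" by blast
    then have "A = set (take (Suc k) (z # zs))" using True by auto
    then show ?thesis by blast
  next
    case False
    have "x \<notin> A" for x
      using Cons.prems(3)[of x z] Cons.prems(2) False by auto
    then have "A = {}" by blast
    then have "A = set (take 0 (z # zs))" by simp
    then show ?thesis by blast
  qed
qed simp

lemma swap_at_conv:
  assumes "1 \<le> k" "k < length xs"
  obtains ys x y zs where "length ys = k - 1" "xs = ys @ x # y # zs"
    "swap_at xs k = ys @ y # x # zs" "sw xs k = {x, y}"
proof -
  obtain j where k: "k = Suc j" using assms(1) by (cases k) auto
  have xs: "xs = take j xs @ xs ! j # xs ! Suc j # drop (Suc (Suc j)) xs"
    using assms(2) unfolding k by (metis Cons_nth_drop_Suc Suc_lessD append_take_drop_id)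
  define ys where "ys = take j xs"
  define zs where "zs = drop (Suc (Suc j)) xs"
  have len: "length ys = j" using assms(2) unfolding ys_def k by simp
  have xs: "xs = ys @ xs ! j # xs ! Suc j # zs" using xs unfolding ys_def zs_def .
  have "swap_at (ys @ x # y # zs) k = ys @ y # x # zs" "sw (ys @ x # y # zs) k = {x, y}" for x y
    unfolding swap_at_def sw_def k by (simp_all add: len[symmetric] nth_append list_update_append)
  from this[of "xs ! j" "xs ! Suc j"] show thesis
    using that[of ys "xs ! j" "xs ! Suc j" zs] len xs unfolding k by simp
qed

lemma before_swap_at:
  assumes "distinct xs" "1 \<le> k" "k < length xs" "x \<noteq> y"
  shows "before (swap_at xs k) x y \<longleftrightarrow> (if {x, y} = sw xs k then before xs y x else before xs x y)"
proof -
  obtain ys p q zs where *: "xs = ys @ p # q # zs" "swap_at xs k = ys @ q # p # zs" "sw xs k = {p, q}"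
    using swap_at_conv[OF assms(2,3)] by metis
  have "distinct (ys @ p # q # zs)" using assms(1) *(1) by simp
  then show ?thesis
    unfolding *(2,3) unfolding *(1) using assms(4) by (auto simp: before_append doubleton_eq_iff dest: before_in_set)
qed

text \<open>A swap at \<open>j \<noteq> k\<close> happens entirely within the first \<open>k\<close>
  entries or entirely after them.\<close>

lemma set_take_swap_at:
  assumes "1 \<le> j" "j < length xs" "j \<noteq> k"
  shows "set (take k (swap_at xs j)) = set (take k xs)"
proof -
  obtain ys p q zs where *: "length ys = j - 1" "xs = ys @ p # q # zs" "swap_at xs j = ys @ q # p # zs"
    using swap_at_conv[OF assms(1,2)] by metis
  show ?thesis
  proof (cases "k < j")
    case True
    then have "k \<le> length ys" using *(1) by simp
    then show ?thesis unfolding *(3) unfolding *(2) by simp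
  next
    case False
    then have "k = length ys + Suc (Suc (k - j - 1))"
      using *(1) assms by simp
    then obtain i where "k = length ys + Suc (Suc i)" ..
    then show ?thesis unfolding *(3) unfolding *(2) by auto
  qed
qed

section \<open>Allowable sequences as sweeps\<close>

lemma swap_seq_ordering:
  assumes "allowable X \<pi> \<kappa>" "i \<le> length \<kappa>"
  shows "distinct (swap_seq \<pi> \<kappa> i) \<and> set (swap_seq \<pi> \<kappa> i) = X \<and> length (swap_seq \<pi> \<kappa> i) = card X"
  using assms(2)
proof (induction i)
  case 0
  then show ?case using assms(1) distinct_card unfolding allowable_def is_ordering_def by fastforce
next
  case (Suc i)
  then have IH: "distinct (swap_seq \<pi> \<kappa> i)" "set (swap_seq \<pi> \<kappa> i) = X" "length (swap_seq \<pi> \<kappa> i) = card X"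
    by auto
  have "\<kappa> ! i \<in> {1..card X - 1}"
    using Suc.prems assms(1) unfolding allowable_def by (auto simp: subset_iff)
  then have "1 \<le> \<kappa> ! i" "\<kappa> ! i < length (swap_seq \<pi> \<kappa> i)" using IH(3) by auto
  from swap_at_conv[OF this] obtain ys x y zs where
    "swap_seq \<pi> \<kappa> i = ys @ x # y # zs" "swap_seq \<pi> \<kappa> (Suc i) = ys @ y # x # zs"
    unfolding swap_seq.simps by metis
  then show ?case using IH by (auto simp del: swap_seq.simps)
qed

text \<open>There are as many steps as two-element subsets of \<open>X\<close> and the swapped pairs
  are distinct, so each pair is swapped exactly once. \<open>T\<close> is the inverse of the map
  from steps to swapped pairs.\<close>

lemma allowable_sweep:
  assumes fin: "finite X" and al: "allowable X \<pi> \<kappa>"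
  obtains T where "sweep X (\<lambda>t. before (swap_seq \<pi> \<kappa> t)) (length \<kappa>) T"
proof -
  define \<sigma> where "\<sigma> t = swap_seq \<pi> \<kappa> t" for t
  define e where "e t = sw (\<sigma> t) (\<kappa> ! t)" for t
  define m where "m = length \<kappa>"
  have ord: "distinct (\<sigma> t)" "set (\<sigma> t) = X" "length (\<sigma> t) = card X" if "t \<le> m" for t
    using swap_seq_ordering[OF al] that unfolding \<sigma>_def m_def by blast+
  have k: "1 \<le> \<kappa> ! t" "\<kappa> ! t < length (\<sigma> t)" if "t < m" for t
  proof -
    have "\<kappa> ! t \<in> {1..card X - 1}"
      using that al unfolding allowable_def m_def by (auto simp: subset_iff)
    then show "1 \<le> \<kappa> ! t" "\<kappa> ! t < length (\<sigma> t)" using ord(3)[of t] that by auto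
  qed
  have "e ` {..<m} = {B. B \<subseteq> X \<and> card B = 2}"
  proof (rule card_subset_eq)
    show "finite {B. B \<subseteq> X \<and> card B = 2}" using fin by simp
    show "e ` {..<m} \<subseteq> {B. B \<subseteq> X \<and> card B = 2}"
    proof
      fix B assume "B \<in> e ` {..<m}"
      then obtain t where t: "t < m" "B = e t" by auto
      from swap_at_conv[OF k[OF t(1)]] obtain ys x y zs where
        "\<sigma> t = ys @ x # y # zs" "e t = {x, y}" unfolding e_def by metis
      then show "B \<in> {B. B \<subseteq> X \<and> card B = 2}" using ord[of t] t by auto
    qed
    have "inj_on e {..<m}" using al unfolding allowable_def e_def \<sigma>_def m_def by blast
    then show "card (e ` {..<m}) = card {B. B \<subseteq> X \<and> card B = 2}"
      using al n_subsets[OF fin, of 2] unfolding allowable_def m_def by (simp add: card_image)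
  qed
  moreover have "inj_on e {..<m}" using al unfolding allowable_def e_def \<sigma>_def m_def by blast
  ultimately have bij: "bij_betw e {..<m} {B. B \<subseteq> X \<and> card B = 2}" unfolding bij_betw_def by blast
  define T where "T = the_inv_into {..<m} e"
  have T: "T {x, y} < m" "e (T {x, y}) = {x, y}" if "x \<in> X" "y \<in> X" "x \<noteq> y" for x y
  proof -
    have "{x, y} \<in> {B. B \<subseteq> X \<and> card B = 2}" using that by auto
    then show "T {x, y} < m" "e (T {x, y}) = {x, y}"
      using bij bij_betwE[OF bij_betw_the_inv_into[OF bij]] f_the_inv_into_f_bij_betw[OF bij]
      unfolding T_def by auto
  qed
  have T_eq: "T {x, y} = t" if "e t = {x, y}" "t < m" for x y t
    using that the_inv_into_f_f[OF bij_betw_imp_inj_on[OF bij], of t] unfolding T_def by simp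
  have flip: "before (\<sigma> t) x y \<longleftrightarrow> (before (\<sigma> 0) x y \<longleftrightarrow> t \<le> T {x, y})"
    if "t \<le> m" "x \<in> X" "y \<in> X" "x \<noteq> y" for t x y
    using that(1)
  proof (induction t)
    case (Suc t)
    then have tm: "t \<le> m" "t < m" by auto
    have step: "before (\<sigma> (Suc t)) x y \<longleftrightarrow> (if {x, y} = e t then before (\<sigma> t) y x else before (\<sigma> t) x y)"
      using before_swap_at[OF ord(1)[OF tm(1)] k[OF tm(2)] that(4)] unfolding \<sigma>_def e_def by simp
    show ?case
    proof (cases "{x, y} = e t")
      case True
      then have "T {x, y} = t" using T_eq[of t x y] tm by simp
      moreover have "before (\<sigma> t) y x \<longleftrightarrow> \<not> before (\<sigma> t) x y"
        using before_total[of x "\<sigma> t" y] before_trans[OF ord(1)[OF tm(1)], of x y x]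
          before_irrefl[OF ord(1)[OF tm(1)]] ord(2)[OF tm(1)] that by blast
      ultimately show ?thesis using step True Suc.IH[OF tm(1)] by auto
    next
      case False
      then have "T {x, y} \<noteq> t" using T(2)[OF that(2-4)] by auto
      then show ?thesis using step False Suc.IH[OF tm(1)] by auto
    qed
  qed simp
  have "sweep X (\<lambda>t. before (\<sigma> t)) m T"
  proof
    show "\<not> before (\<sigma> t) x x" if "t \<le> m" for t x
      by (rule before_irrefl[OF ord(1)[OF that]])
    show "before (\<sigma> t) x z" if "t \<le> m" "before (\<sigma> t) x y" "before (\<sigma> t) y z" for t x y z
      by (rule before_trans[OF ord(1)[OF that(1)] that(2,3)])
    show "before (\<sigma> t) x y \<or> before (\<sigma> t) y x" if "t \<le> m" "x \<in> X" "y \<in> X" "x \<noteq> y" for t x y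
      using before_total[of x "\<sigma> t" y] ord(2)[OF that(1)] that(2-4) by simp
    show "{x, y} = {u, v}"
      if "x \<in> X" "y \<in> X" "x \<noteq> y" "u \<in> X" "v \<in> X" "u \<noteq> v" "T {x, y} = T {u, v}" for x y u v
    proof -
      have "{x, y} = e (T {u, v})" unfolding that(7)[symmetric] by (rule T(2)[OF that(1-3), symmetric])
      also have "\<dots> = {u, v}" by (rule T(2)[OF that(4-6)])
      finally show ?thesis .
    qed
  qed (fact fin T(1) flip)+
  then show thesis using that unfolding \<sigma>_def m_def by blast
qed

text \<open>Follow an initial segment of size \<open>k\<close> forward in time: it changes only at a
  swap at position \<open>k\<close>, which records its split. A segment met by no such swap survives
  to the end; the complement, initial at time 0, is then followed in the same way.\<close>

lemma allowable_splits_eq_cells: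
  assumes al: "allowable X \<pi> \<kappa>" and sw: "sweep X (\<lambda>t. before (swap_seq \<pi> \<kappa> t)) (length \<kappa>) T"
  shows "allowable_splits \<pi> \<kappa> = sweep.cells X (\<lambda>t. before (swap_seq \<pi> \<kappa> t)) (length \<kappa>)"
proof -
  define \<sigma> where "\<sigma> t = swap_seq \<pi> \<kappa> t" for t
  define m where "m = length \<kappa>"
  interpret sweep X "\<lambda>t. before (\<sigma> t)" m T
    using sw unfolding \<sigma>_def m_def .
  have ord: "distinct (\<sigma> t)" "set (\<sigma> t) = X" "length (\<sigma> t) = card X" if "t \<le> m" for t
    using swap_seq_ordering[OF al] that unfolding \<sigma>_def m_def by blast+
  have k: "1 \<le> \<kappa> ! t" "\<kappa> ! t < card X" if "t < m" for t
  proof -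
    have "\<kappa> ! t \<in> {1..card X - 1}"
      using that al unfolding allowable_def m_def by (auto simp: subset_iff)
    then show "1 \<le> \<kappa> ! t" "\<kappa> ! t < card X" by auto
  qed
  have initial_take: "initial t (set (take k (\<sigma> t)))" if "t \<le> m" for t k
    using before_take[OF ord(1)[OF that]] ord(2)[OF that] set_take_subset[of k "\<sigma> t"]
    unfolding initial_def by blast
  have take_initial: "\<exists>k. A = set (take k (\<sigma> t))" if "t \<le> m" "initial t A" for t A
    using before_closed_imp_take[OF ord(1)[OF that(1)], of A] that(2) ord(2)[OF that(1)]
      before_in_set[of "\<sigma> t"] unfolding initial_def by blast
  have set_drop: "set (drop k (\<sigma> t)) = X - set (take k (\<sigma> t))" if "t \<le> m" for t k
  proof -
    have "set (take k (\<sigma> t)) \<union> set (drop k (\<sigma> t)) = X"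
      using ord(2)[OF that] by (metis append_take_drop_id set_append)
    then show ?thesis
      using set_take_disj_set_drop_if_distinct[OF ord(1)[OF that] order_refl, of k] by blast
  qed
  have reach: "{A, X - A} \<in> allowable_splits \<pi> \<kappa> \<or> initial m A" if "t \<le> m" "A = set (take k (\<sigma> t))" for t A k
    using that
  proof (induction t rule: inc_induct)
    case base
    then show ?case using initial_take by auto
  next
    case (step t)
    show ?case
    proof (cases "\<kappa> ! t = k")
      case True
      then have "{A, X - A} = prefix_split (\<sigma> t) (\<kappa> ! t)"
        using step.prems set_drop[of t k] step.hyps unfolding prefix_split_def by simp
      then show ?thesis
        using step.hyps unfolding allowable_splits_def \<sigma>_def m_def by auto
    next
      case False
      then have "set (take k (\<sigma> (Suc t))) = set (take k (\<sigma> t))"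
        using set_take_swap_at[of "\<kappa> ! t" "\<sigma> t" k] k[of t] ord(3)[of t] step.hyps
        unfolding \<sigma>_def by simp
      then show ?thesis using step by simp
    qed
  qed
  have "S \<in> allowable_splits \<pi> \<kappa>" if S: "S \<in> cells" for S
  proof -
    obtain A t where A: "S = {A, X - A}" "t \<le> m" "initial t A" "A \<noteq> {}" "A \<noteq> X"
      using S unfolding cells_def by blast
    have AX: "A \<subseteq> X" using A(3) unfolding initial_def by blast
    show ?thesis
    proof (rule ccontr)
      assume no: "S \<notin> allowable_splits \<pi> \<kappa>"
      then have Am: "initial m A" using reach take_initial A by metis
      \<comment> \<open>The final order reverses the original one. If the complement also survived
        to time \<open>m\<close>, two disjoint non-empty sets would both be initial there, which is
        impossible.\<close>
      have "initial 0 (X - A)"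
        unfolding initial_def
      proof (intro conjI ballI impI)
        fix x y assume x: "x \<in> X - A" and y: "y \<in> X" and yx: "before (\<sigma> 0) y x"
        then have "x \<noteq> y" using irrefl[of 0] by auto
        then have "\<not> before (\<sigma> m) y x"
          using flip[of m y x] T_less[of y x] x y yx by auto
        then have "before (\<sigma> m) x y" using total[of m x y] x y \<open>x \<noteq> y\<close> by auto
        then show "y \<in> X - A" using Am x y unfolding initial_def by blast
      qed auto
      then obtain k where "X - A = set (take k (\<sigma> 0))" using take_initial by blast
      moreover have "{X - A, X - (X - A)} = S" using A(1) AX by auto
      ultimately have "initial m (X - A)" using reach[of 0 "X - A" k] no by auto
      moreover obtain a b where "a \<in> A" "b \<in> X - A" using A(4,5) AX by blast
      moreover from this have "before (\<sigma> m) a b \<or> before (\<sigma> m) b a" using total[of m a b] AX by blast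
      ultimately show False using Am unfolding initial_def by blast
    qed
  qed
  moreover have "S \<in> cells" if S: "S \<in> allowable_splits \<pi> \<kappa>" for S
  proof -
    obtain t where t: "t < m" "S = prefix_split (\<sigma> t) (\<kappa> ! t)"
      using S unfolding allowable_splits_def \<sigma>_def m_def by auto
    define A where "A = set (take (\<kappa> ! t) (\<sigma> t))"
    have "card A = \<kappa> ! t"
      using t(1) ord[of t] k[of t] unfolding A_def by (subst distinct_card) auto
    then have "A \<noteq> {}" "A \<noteq> X" using k[OF t(1)] by auto
    moreover have "S = {A, X - A}"
      using t set_drop[of t] unfolding A_def prefix_split_def by simp
    moreover have "t \<le> m" "initial t A"
      using initial_take[of t "\<kappa> ! t"] t(1) unfolding A_def by auto
    ultimately show ?thesis
      unfolding cells_def by blast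
  qed
  ultimately show ?thesis unfolding \<sigma>_def m_def by blast
qed

section \<open>The equivalence for maximum flat systems\<close>

theorem theorem5:
  fixes X :: "'a set" and \<S> :: "'a set set set" and n :: nat
  assumes "finite X" and "card X = n" and "n \<ge> 5"
    and "maximum_flat X \<S>"
  shows "orderly X \<S> \<longleftrightarrow> circular X \<S>"
proof
  assume "circular X \<S>"
  then obtain \<pi> where \<pi>: "is_ordering X \<pi>" "\<S> \<subseteq> circular_splits X \<pi>"
    unfolding circular_iff_subset by blast
  have "\<S> = circular_splits X \<pi>"
    using card_seteq[OF card_circular_splits(1) \<pi>(2)] card_circular_splits(2)[of X \<pi>] assms(4)
    unfolding maximum_flat_def by simp
  then show "orderly X \<S>" using orderly_circular_splits[OF assms(1) \<pi>(1)] by simp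
next
  assume ord: "orderly X \<S>"
  obtain \<pi> \<kappa> where al: "allowable X \<pi> \<kappa>" and sub: "\<S> \<subseteq> allowable_splits \<pi> \<kappa>"
    using assms(4) unfolding maximum_flat_def flat_def by blast
  have "finite (allowable_splits \<pi> \<kappa>)" "card (allowable_splits \<pi> \<kappa>) \<le> card X choose 2"
    using al card_image_le[of "{..<length \<kappa>}"] unfolding allowable_splits_def allowable_def by fastforce+
  \<comment> \<open>A flat system of maximum size exhausts the allowable splits, hence all cells of
    the sweep.\<close>
  then have eq: "\<S> = allowable_splits \<pi> \<kappa>"
    using card_seteq[OF _ sub] assms(4) unfolding maximum_flat_def by simp
  obtain T where "sweep X (\<lambda>t. before (swap_seq \<pi> \<kappa> t)) (length \<kappa>) T"
    using allowable_sweep[OF assms(1) al] .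
  then show "circular X \<S>"
    using sweep.orderly_imp_circular ord assms(2,3) allowable_splits_eq_cells[OF al] eq by metis
qed

end
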